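(* Let $T$ be a tree with diameter $2$ or $3$. Then $cfc(T)=\Delta(T)$, where $\Delta(T)$ is the maximum degree of $T$.
   Context: All graphs are simple, finite and undirected. In an edge-colored graph (adjacent edges are allowed to share a color), a path is called conflict-free if there is a color used on exactly one of its edges. An edge-colored graph is conflict-free connected if every pair of distinct vertices is connected by a conflict-free path. For a connected graph $G$, the conflict-free connection number $cfc(G)$ is the smallest number of colors in an edge-coloring that makes $G$ conflict-free connected. *)

theory Defs
  imports Main
begin

text \<open>A graph is a pair of a vertex set and a set of edges, an edge being the
  two-element set of its endpoints.\<close>

definition simple_graph :: "'a set \<Rightarrow> 'a set set \<Rightarrow> bool" where
  "simple_graph V E \<longleftrightarrow> finite V \<and> (\<forall>e\<in>E. e \<subseteq> V \<and> card e = 2)"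

definition degree :: "'a set set \<Rightarrow> 'a \<Rightarrow> nat" where
  "degree E v = card {e \<in> E. v \<in> e}"

definition max_degree :: "'a set \<Rightarrow> 'a set set \<Rightarrow> nat" where
  "max_degree V E = Max (degree E ` V)"

text \<open>Paths are given by their lists of pairwise distinct vertices; a one-vertex list
  is the path of length 0.\<close>

definition is_path :: "'a set \<Rightarrow> 'a set set \<Rightarrow> 'a list \<Rightarrow> bool" where
  "is_path V E p \<longleftrightarrow>
     p \<noteq> [] \<and> distinct p \<and> set p \<subseteq> V \<and> successively (\<lambda>x y. {x, y} \<in> E) p"

definition path_between :: "'a set \<Rightarrow> 'a set set \<Rightarrow> 'a \<Rightarrow> 'a \<Rightarrow> 'a list \<Rightarrow> bool" where
  "path_between V E u v p \<longleftrightarrow> is_path V E p \<and> hd p = u \<and> last p = v"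

definition path_edges :: "'a list \<Rightarrow> 'a set list" where
  "path_edges p = map2 (\<lambda>x y. {x, y}) p (tl p)"

definition path_length :: "'a list \<Rightarrow> nat" where
  "path_length p = length (path_edges p)"

definition graph_connected :: "'a set \<Rightarrow> 'a set set \<Rightarrow> bool" where
  "graph_connected V E \<longleftrightarrow> V \<noteq> {} \<and> (\<forall>u\<in>V. \<forall>v\<in>V. \<exists>p. path_between V E u v p)"

text \<open>A cycle is given by a path on at least three vertices whose ends are adjacent.\<close>

definition is_cycle :: "'a set \<Rightarrow> 'a set set \<Rightarrow> 'a list \<Rightarrow> bool" where
  "is_cycle V E p \<longleftrightarrow> is_path V E p \<and> 3 \<le> length p \<and> {last p, hd p} \<in> E"

definition is_tree :: "'a set \<Rightarrow> 'a set set \<Rightarrow> bool" where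
  "is_tree V E \<longleftrightarrow> simple_graph V E \<and> graph_connected V E \<and> (\<nexists>p. is_cycle V E p)"

text \<open>Distance and diameter are meaningful for connected graphs only.\<close>

definition graph_dist :: "'a set \<Rightarrow> 'a set set \<Rightarrow> 'a \<Rightarrow> 'a \<Rightarrow> nat" where
  "graph_dist V E u v = (LEAST n. \<exists>p. path_between V E u v p \<and> path_length p = n)"

definition diameter :: "'a set \<Rightarrow> 'a set set \<Rightarrow> nat" where
  "diameter V E = Max {graph_dist V E u v | u v. u \<in> V \<and> v \<in> V}"

text \<open>An edge-coloring is an arbitrary map on edges (no properness is required); only its
  values on the edge set matter.\<close>

definition conflict_free_path :: "('a set \<Rightarrow> 'c) \<Rightarrow> 'a list \<Rightarrow> bool" where
  "conflict_free_path c p \<longleftrightarrow> (\<exists>k. \<exists>!e. e \<in> set (path_edges p) \<and> c e = k)"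

definition conflict_free_connected ::
    "'a set \<Rightarrow> 'a set set \<Rightarrow> ('a set \<Rightarrow> 'c) \<Rightarrow> bool" where
  "conflict_free_connected V E c \<longleftrightarrow>
     (\<forall>u\<in>V. \<forall>v\<in>V. u \<noteq> v \<longrightarrow> (\<exists>p. path_between V E u v p \<and> conflict_free_path c p))"

text \<open>Since the edge set is finite, taking the colors to be natural numbers is no
  restriction.\<close>

definition cfc :: "'a set \<Rightarrow> 'a set set \<Rightarrow> nat" where
  "cfc V E =
     (LEAST n. \<exists>c :: 'a set \<Rightarrow> nat. conflict_free_connected V E c \<and> card (c ` E) = n)"

end

theory Submission
  imports Defs
begin

text \<open>In a tree two edges at a common vertex form the only path between their other ends, so a
  conflict-free connected coloring is proper and uses at least \<open>\<Delta>\<close> colors. Conversely, a tree of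
  diameter 2 or 3 has an edge \<open>uv\<close> that meets all other edges. Color \<open>uv\<close> with 0, and color the
  other edges at \<open>u\<close> injectively with positive colors, and those at \<open>v\<close> likewise, independently
  of each other. A path through \<open>uv\<close> is conflict-free due to color 0, and two vertices not joined
  by such a path are joined by two edges at \<open>u\<close> or at \<open>v\<close>, which have distinct colors.\<close>

section \<open>Path lists, their edges, and how they split and reverse\<close>

lemma path_length_eq: "path_length p = length p - 1"
  by (simp add: path_length_def path_edges_def)

lemma path_edges_append: "path_edges (p @ x # q) = path_edges (p @ [x]) @ path_edges (x # q)"
proof (induction p)
  case (Cons a p)
  then show ?case by (cases p) (auto simp: path_edges_def)
qed (simp add: path_edges_def)

lemma path_edges_rev: "path_edges (rev p) = rev (path_edges p)"
proof (induction p rule: induct_list012)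
  case (3 x y p)
  then show ?case
    using path_edges_append[of "rev p" y "[x]"] by (simp add: path_edges_def insert_commute)
qed (simp_all add: path_edges_def)

lemma is_path_append_iff:
  assumes "p \<noteq> []" "q \<noteq> []"
  shows "is_path V E (p @ q) \<longleftrightarrow>
    is_path V E p \<and> is_path V E q \<and> set p \<inter> set q = {} \<and> {last p, hd q} \<in> E"
  using assms by (auto simp: is_path_def successively_append_iff)

lemma is_path_appendD1: "is_path V E (p @ q) \<Longrightarrow> p \<noteq> [] \<Longrightarrow> is_path V E p"
  by (cases "q = []") (auto simp: is_path_append_iff)

lemma is_path_rev: "is_path V E (rev p) \<longleftrightarrow> is_path V E p"
  by (auto simp: is_path_def successively_rev insert_commute)

lemma is_path_single: "is_path V E [x] \<longleftrightarrow> x \<in> V"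
  by (simp add: is_path_def)

lemma is_path_Cons_iff:
  assumes "p \<noteq> []"
  shows "is_path V E (x # p) \<longleftrightarrow> x \<in> V \<and> is_path V E p \<and> x \<notin> set p \<and> {x, hd p} \<in> E"
  using is_path_append_iff[of "[x]" p V E] assms by (auto simp: is_path_single)

section \<open>Unique paths, distances and diameter in acyclic graphs\<close>

text \<open>Induction strips the common first vertex as long as the paths agree. Where they first
  part, after \<open>u\<close>, they meet again at the latest in \<open>v\<close>, and the two
  pieces from \<open>u\<close> to the meeting vertex form a cycle.\<close>

lemma acyclic_path_unique:
  assumes acyclic: "\<nexists>p. is_cycle V E p"
    and "path_between V E u v p" "path_between V E u v q"
  shows "p = q"
  using assms(2,3)
proof (induction p arbitrary: u q)
  case Nil
  then show ?case by (simp add: path_between_def is_path_def)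
next
  case (Cons x p')
  from Cons.prems obtain q' where x: "x = u" and q: "q = u # q'"
    by (cases q) (auto simp: path_between_def is_path_def)
  show ?case
  proof (cases "u = v")
    case True
    with Cons.prems x q have "p' = []" "q' = []"
      by (auto simp: path_between_def is_path_def split: if_splits)
    with x q show ?thesis by simp
  next
    case False
    with Cons.prems x q have ne: "p' \<noteq> []" "q' \<noteq> []"
      by (auto simp: path_between_def)
    from Cons.prems x q ne
    have p': "is_path V E p'" "u \<notin> set p'" "{u, hd p'} \<in> E" "last p' = v" "u \<in> V"
      and q': "is_path V E q'" "u \<notin> set q'" "{u, hd q'} \<in> E" "last q' = v"
      by (auto simp: path_between_def is_path_Cons_iff)
    have "v \<in> set p'" "v \<in> set q'"
      using p'(4) q'(4) last_in_set[OF ne(1)] last_in_set[OF ne(2)] by simp_all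
    \<comment> \<open>\<open>z\<close> is the first vertex of \<open>p'\<close> that also lies on
      \<open>q'\<close>, so the piece \<open>xs\<close> before it is disjoint from
      \<open>q'\<close>.\<close>
    then obtain xs z ys where sp: "p' = xs @ z # ys" and z: "z \<in> set q'"
      and xs: "\<forall>y\<in>set xs. y \<notin> set q'"
      using split_list_first_prop[of p' "\<lambda>y. y \<in> set q'"] by blast
    from z obtain xs' ys' where sq: "q' = xs' @ z # ys'"
      using split_list by metis
    show ?thesis
    proof (cases "hd p' = hd q'")
      case True
      with p' q' have "p' = q'"
        by (intro Cons.IH[of "hd p'"]) (auto simp: path_between_def)
      with x q show ?thesis by simp
    next
      case False
      \<comment> \<open>From \<open>u\<close> along \<open>p'\<close> to \<open>z\<close>, then back
        along \<open>q'\<close> to its first vertex, which is adjacent to \<open>u\<close>.\<close>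
      let ?c = "u # (xs @ [z]) @ rev xs'"
      have "is_path V E ((xs @ [z]) @ ys)" "is_path V E ((xs' @ [z]) @ ys')"
        using p'(1) q'(1) sp sq by auto
      then have a: "is_path V E (xs @ [z])" and b: "is_path V E (xs' @ [z])"
        by (blast dest: is_path_appendD1)+
      have "is_path V E ((xs @ [z]) @ rev xs')"
      proof (cases "xs' = []")
        case True
        with a show ?thesis by simp
      next
        case xs': False
        with b have "is_path V E (rev xs')" "{last xs', z} \<in> E" "z \<notin> set xs'"
          by (auto simp: is_path_append_iff is_path_rev)
        with xs' a xs sq show ?thesis
          by (subst is_path_append_iff) (auto simp: hd_rev insert_commute)
      qed
      moreover have "hd ((xs @ [z]) @ rev xs') = hd p'"
        using sp by (cases xs) auto
      ultimately have "is_path V E ?c"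
        using p' q' sp sq by (subst is_path_Cons_iff) auto
      moreover have "last ?c = hd q'"
        using sq by (cases xs') auto
      \<comment> \<open>If \<open>xs\<close> and \<open>xs'\<close> were both empty,
        \<open>z\<close> would be the head of both \<open>p'\<close> and \<open>q'\<close>, but the
        heads differ.\<close>
      moreover have "length ?c \<ge> 3"
        using False sp sq by (cases xs; cases xs') auto
      ultimately have "is_cycle V E ?c"
        using q' by (simp add: is_cycle_def insert_commute)
      with acyclic show ?thesis by blast
    qed
  qed
qed

lemma acyclic_graph_dist_eq:
  assumes "\<nexists>p. is_cycle V E p" "path_between V E u v p"
  shows "graph_dist V E u v = path_length p"
  unfolding graph_dist_def
proof (rule Least_equality)
  show "\<exists>q. path_between V E u v q \<and> path_length q = path_length p"
    using assms(2) by blast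
next
  fix n assume "\<exists>q. path_between V E u v q \<and> path_length q = n"
  then show "path_length p \<le> n"
    using acyclic_path_unique[OF assms] by blast
qed

lemma finite_graph_dists:
  assumes "finite V"
  shows "finite {graph_dist V E u v | u v. u \<in> V \<and> v \<in> V}"
proof -
  have "{graph_dist V E u v | u v. u \<in> V \<and> v \<in> V} = (\<lambda>(u, v). graph_dist V E u v) ` (V \<times> V)"
    by auto
  with assms show ?thesis by simp
qed

text \<open>Every path of a tree is the only one between its ends, hence a shortest one. So the
  diameter, a bound on distances, bounds the lengths of all paths.\<close>

lemma tree_path_length_le_diameter:
  assumes "is_tree V E" "is_path V E p"
  shows "path_length p \<le> diameter V E"
proof -
  from assms(2) have "path_between V E (hd p) (last p) p"
    by (simp add: path_between_def)
  with assms(1) have "graph_dist V E (hd p) (last p) = path_length p"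
    by (intro acyclic_graph_dist_eq) (auto simp: is_tree_def)
  moreover have "hd p \<in> V" "last p \<in> V"
    using assms(2) by (auto simp: is_path_def)
  ultimately show ?thesis
    unfolding diameter_def using assms(1)
    by (intro Max_ge finite_graph_dists) (auto simp: is_tree_def simple_graph_def, metis)
qed

lemma tree_diameter_path:
  assumes "is_tree V E"
  obtains p where "is_path V E p" "path_length p = diameter V E"
proof -
  let ?D = "{graph_dist V E u v | u v. u \<in> V \<and> v \<in> V}"
  from assms have "finite V" "V \<noteq> {}"
    by (simp_all add: is_tree_def simple_graph_def graph_connected_def)
  then have "finite ?D" "?D \<noteq> {}"
    using finite_graph_dists by blast+
  then have "diameter V E \<in> ?D"
    unfolding diameter_def by (rule Max_in)
  then obtain u v where uv: "u \<in> V" "v \<in> V" "diameter V E = graph_dist V E u v"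
    by blast
  with assms obtain p where "path_between V E u v p"
    unfolding is_tree_def graph_connected_def by blast
  moreover from this assms have "graph_dist V E u v = path_length p"
    by (intro acyclic_graph_dist_eq) (simp_all add: is_tree_def)
  ultimately show thesis
    using uv by (intro that) (simp_all add: path_between_def)
qed

section \<open>An edge that meets all edges of the tree\<close>

text \<open>A longer path to \<open>u\<close> avoiding \<open>v\<close> could be continued through \<open>v\<close> to \<open>b\<close>.\<close>

lemma acyclic_path_to_avoiding:
  assumes acyclic: "\<nexists>p. is_cycle V E p"
    and short: "\<And>p. is_path V E p \<Longrightarrow> path_length p \<le> 3"
    and uvb: "is_path V E [u, v, b]"
    and q: "path_between V E w u q" and v: "v \<notin> set q"
  shows "length q \<le> 2"
proof -
  \<comment> \<open>If \<open>b\<close> were on \<open>q\<close>, the rest of \<open>q\<close> from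
    \<open>b\<close> to \<open>u\<close> would be the unique path \<open>[b, v, u]\<close>, but
    \<open>q\<close> avoids \<open>v\<close>.\<close>
  have b: "b \<notin> set q"
  proof
    assume "b \<in> set q"
    then obtain xs ys where s: "q = xs @ b # ys"
      by (meson split_list)
    with q have "path_between V E b u (b # ys)"
      by (cases "xs = []") (auto simp: path_between_def is_path_append_iff)
    moreover have "path_between V E b u [b, v, u]"
      using uvb is_path_rev[of V E "[u, v, b]"] by (simp add: path_between_def)
    ultimately have "b # ys = [b, v, u]"
      using acyclic_path_unique[OF acyclic] by blast
    with s v show False by simp
  qed
  \<comment> \<open>This path has \<open>length q + 1\<close> edges, so the bound 3 leaves at most
    two vertices for \<open>q\<close>.\<close>
  have "is_path V E (q @ [v, b])"
    using q v b uvb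
    by (subst is_path_append_iff) (auto simp: path_between_def is_path_Cons_iff is_path_def)
  from short[OF this] show ?thesis
    by (simp add: path_length_eq)
qed

text \<open>Cutting \<open>q\<close> at \<open>v\<close> drops its final vertex \<open>u\<close>.
  This turns a path to \<open>u\<close> through \<open>v\<close> into one to which the bound for
  paths to \<open>v\<close> avoiding \<open>u\<close> applies.\<close>

lemma path_prefix_to:
  assumes q: "path_between V E w u q" and v: "v \<in> set q" "v \<noteq> u"
  obtains q' where "path_between V E w v q'" "u \<notin> set q'"
proof -
  from v obtain xs ys where s: "q = xs @ v # ys"
    by (meson split_list)
  with q v have ys: "ys \<noteq> []"
    by (auto simp: path_between_def)
  from q s have "is_path V E ((xs @ [v]) @ ys)" "last ys = u"
    using ys by (auto simp: path_between_def)
  then have "is_path V E (xs @ [v])" "set (xs @ [v]) \<inter> set ys = {}" "u \<in> set ys"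
    using ys last_in_set[OF ys] is_path_append_iff[of "xs @ [v]" ys V E] by blast+
  then have "is_path V E (xs @ [v])" "u \<notin> set (xs @ [v])"
    by blast+
  moreover have "hd (xs @ [v]) = w"
    using q s by (cases xs) (auto simp: path_between_def)
  ultimately show thesis
    by (intro that[of "xs @ [v]"]) (simp_all add: path_between_def)
qed

lemma path_between_length_le_2:
  assumes "path_between V E w u q" "length q \<le> 2" "w \<noteq> u"
  shows "{w, u} \<in> E"
proof (cases q)
  case Nil
  with assms show ?thesis by (simp add: path_between_def is_path_def)
next
  case (Cons x q')
  with assms show ?thesis
    by (cases q') (auto simp: path_between_def is_path_def)
qed

text \<open>The edge \<open>uv\<close> is the middle edge of a longest path if the diameter is 3,
  and the last edge of one if it is 2. Every other vertex turns out to be adjacent to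
  \<open>u\<close> or \<open>v\<close>, so an edge missing both would close a cycle of length 3 or
  4.\<close>

lemma tree_edge_meeting_all_edges:
  assumes tree: "is_tree V E" and diam: "diameter V E = 2 \<or> diameter V E = 3"
  obtains u v where "u \<noteq> v" "{u, v} \<in> E" "\<And>e. e \<in> E \<Longrightarrow> u \<in> e \<or> v \<in> e"
proof -
  from tree have acyclic: "\<nexists>p. is_cycle V E p" and simple: "simple_graph V E"
    and conn: "graph_connected V E"
    by (auto simp: is_tree_def)
  have short: "path_length p \<le> 3" if "is_path V E p" for p
    using tree_path_length_le_diameter[OF tree that] diam by auto
  obtain p where p: "is_path V E p" "path_length p = diameter V E"
    using tree_diameter_path[OF tree] .
  \<comment> \<open>Both diameters give this bound at \<open>u\<close>. The bound at
    \<open>v\<close> then follows uniformly from the vertex \<open>a\<close>.\<close>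
  have "\<exists>a u v. is_path V E [a, u, v] \<and>
    (\<forall>w q. path_between V E w u q \<longrightarrow> v \<notin> set q \<longrightarrow> length q \<le> 2)"
    using diam
  proof
    assume d: "diameter V E = 2"
    with p have "length p = Suc (Suc (Suc 0))"
      by (simp add: path_length_eq)
    then obtain a u v where auv: "p = [a, u, v]"
      by (auto simp: length_Suc_conv)
    have "length q \<le> 2" if "path_between V E w u q" "v \<notin> set q" for w q
    proof -
      have "is_path V E (q @ [v])"
        using that p auv
        by (subst is_path_append_iff) (auto simp: path_between_def is_path_def)
      from tree_path_length_le_diameter[OF tree this] d show ?thesis
        by (simp add: path_length_eq)
    qed
    with p auv show ?thesis by blast
  next
    assume d: "diameter V E = 3"
    with p have "length p = Suc (Suc (Suc (Suc 0)))"
      by (simp add: path_length_eq)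
    then obtain a u v b where "p = [a, u, v, b]"
      by (auto simp: length_Suc_conv)
    with p have "is_path V E [a, u, v]" "is_path V E [u, v, b]"
      by (auto simp: is_path_def)
    with acyclic_path_to_avoiding[OF acyclic short] show ?thesis by blast
  qed
  then obtain a u v where auv: "is_path V E [a, u, v]"
    and to_u: "\<And>w q. path_between V E w u q \<Longrightarrow> v \<notin> set q \<Longrightarrow> length q \<le> 2"
    by blast
  \<comment> \<open>The reversed path \<open>[v, u, a]\<close> takes the place of
    \<open>[u, v, b]\<close>, with \<open>u\<close> and \<open>v\<close> swapped.\<close>
  have to_v: "length q \<le> 2" if "path_between V E w v q" "u \<notin> set q" for w q
    using acyclic_path_to_avoiding[OF acyclic short _ that] auv is_path_rev[of V E "[a, u, v]"]
    by simp
  from auv have uv: "u \<noteq> v" "{u, v} \<in> E" "u \<in> V" "v \<in> V"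
    by (auto simp: is_path_def)
  have near: "{w, u} \<in> E \<or> {w, v} \<in> E" if w: "w \<in> V" "w \<noteq> u" "w \<noteq> v" for w
  proof -
    from conn w uv obtain q where q: "path_between V E w u q"
      by (auto simp: graph_connected_def)
    show ?thesis
    proof (cases "v \<in> set q")
      case True
      with q uv obtain q' where "path_between V E w v q'" "u \<notin> set q'"
        using path_prefix_to by metis
      with w to_v show ?thesis
        using path_between_length_le_2 by metis
    next
      case False
      with q w to_u show ?thesis
        using path_between_length_le_2 by metis
    qed
  qed
  have "u \<in> e \<or> v \<in> e" if e: "e \<in> E" for e
  proof (rule ccontr)
    assume not: "\<not> (u \<in> e \<or> v \<in> e)"
    from e simple obtain s t where st: "e = {s, t}" "s \<noteq> t" "s \<in> V" "t \<in> V"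
      by (auto simp: simple_graph_def card_2_iff)
    \<comment> \<open>\<open>tri\<close> covers ends \<open>s\<close> and \<open>t\<close> with a
      common neighbor among \<open>u\<close> and \<open>v\<close>; \<open>quad\<close> covers
      neighbors at different ends of \<open>uv\<close>.\<close>
    have tri: False if "{s, x} \<in> E" "{t, x} \<in> E" "x = u \<or> x = v" for x
    proof -
      have "is_cycle V E [s, x, t]"
        using that st not uv e by (auto simp: is_cycle_def is_path_def insert_commute)
      with acyclic show False by blast
    qed
    have quad: False if "{s, x} \<in> E" "{t, y} \<in> E" "x = u \<and> y = v \<or> x = v \<and> y = u" for x y
    proof -
      have "is_cycle V E [s, x, y, t]"
        using that st not uv e by (auto simp: is_cycle_def is_path_def insert_commute)
      with acyclic show False by blast
    qed
    show False
      using near[of s] near[of t] st not tri quad by blast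
  qed
  with uv that show thesis by blast
qed

section \<open>Lower bound: conflict-free connected colorings are injective on stars\<close>

lemma max_degree_le_conflict_free_colors:
  assumes tree: "is_tree V E" and cf: "conflict_free_connected V E c"
  shows "max_degree V E \<le> card (c ` E)"
proof -
  from tree have acyclic: "\<nexists>p. is_cycle V E p" and simple: "simple_graph V E" and "V \<noteq> {}"
    by (auto simp: is_tree_def graph_connected_def)
  have "finite V" using simple by (simp add: simple_graph_def)
  have "E \<subseteq> Pow V" using simple by (auto simp: simple_graph_def)
  with \<open>finite V\<close> have finE: "finite E" by (meson finite_Pow_iff finite_subset)
  have "degree E v \<le> card (c ` E)" if v: "v \<in> V" for v
  proof -
    have "inj_on c {e \<in> E. v \<in> e}"
    proof (rule inj_onI, rule ccontr)
      fix e e' assume e: "e \<in> {e \<in> E. v \<in> e}" and e': "e' \<in> {e \<in> E. v \<in> e}"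
        and eq: "c e = c e'" and ne: "e \<noteq> e'"
      have "\<exists>x. e = {x, v} \<and> x \<noteq> v \<and> x \<in> V" if "e \<in> E" "v \<in> e" for e
        using that simple by (fastforce simp: simple_graph_def card_2_iff)
      with e e' obtain x y where xy: "e = {x, v}" "x \<noteq> v" "x \<in> V" "e' = {y, v}" "y \<noteq> v" "y \<in> V"
        by blast
      with ne have "x \<noteq> y" by auto
      with xy cf obtain p where p: "path_between V E x y p" "conflict_free_path c p"
        by (auto simp: conflict_free_connected_def)
      have "path_between V E x y [x, v, y]"
        using xy \<open>x \<noteq> y\<close> v e e' by (auto simp: path_between_def is_path_def insert_commute)
      with p(1) have "p = [x, v, y]"
        using acyclic_path_unique[OF acyclic] by blast
      then have "set (path_edges p) = {e, e'}"
        using xy by (auto simp: path_edges_def)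
      \<comment> \<open>As \<open>c e = c e'\<close>, each color is used on both edges of the path
        or on neither, never on exactly one.\<close>
      with p(2) obtain k where "\<exists>!d. d \<in> {e, e'} \<and> c d = k"
        by (auto simp: conflict_free_path_def)
      with eq ne show False
        by (metis insertCI insertE singletonD)
    qed
    then have "degree E v = card (c ` {e \<in> E. v \<in> e})"
      by (simp add: degree_def card_image)
    also have "\<dots> \<le> card (c ` E)"
      using finE by (intro card_mono) auto
    finally show ?thesis .
  qed
  with \<open>finite V\<close> \<open>V \<noteq> {}\<close> show ?thesis
    by (simp add: max_degree_def)
qed

section \<open>Upper bound: a coloring from the edge that meets all edges\<close>

text \<open>The stars at \<open>u\<close> and \<open>v\<close> share only the edge \<open>uv\<close>
  and may reuse each other's positive colors, because a path with edges from both stars can be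
  routed through \<open>uv\<close>. Hence the maximum of the two degrees suffices, rather than their
  sum.\<close>

lemma conflict_free_coloring_of_edge_meeting_all_edges:
  assumes simple: "simple_graph V E" and conn: "graph_connected V E"
    and uv: "u \<noteq> v" "{u, v} \<in> E" and meet: "\<And>e. e \<in> E \<Longrightarrow> u \<in> e \<or> v \<in> e"
  obtains c :: "'a set \<Rightarrow> nat"
  where "conflict_free_connected V E c" "card (c ` E) \<le> max (degree E u) (degree E v)"
proof -
  have "finite V" using simple by (simp add: simple_graph_def)
  have "E \<subseteq> Pow V" using simple by (auto simp: simple_graph_def)
  with \<open>finite V\<close> have finE: "finite E" by (meson finite_Pow_iff finite_subset)
  have uvV: "u \<in> V" "v \<in> V" using uv simple by (auto simp: simple_graph_def)
  let ?e0 = "{u, v}"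
  \<comment> \<open>Without \<open>uv\<close>, the star at \<open>w\<close> has
    \<open>degree E w - 1\<close> edges, exactly the size of \<open>{1..<degree E w}\<close>; color
    0 stays free for \<open>uv\<close>.\<close>
  have star: "\<exists>f :: 'a set \<Rightarrow> nat. f ` ({e \<in> E. w \<in> e} - {?e0}) \<subseteq> {1..<degree E w} \<and>
    inj_on f ({e \<in> E. w \<in> e} - {?e0})" if "w = u \<or> w = v" for w
  proof (rule card_le_inj)
    show "card ({e \<in> E. w \<in> e} - {?e0}) \<le> card {1..<degree E w}"
      using that uv finE by (subst card_Diff_singleton) (auto simp: degree_def)
  qed (use finE in auto)
  obtain f :: "'a set \<Rightarrow> nat" where f: "f ` ({e \<in> E. u \<in> e} - {?e0}) \<subseteq> {1..<degree E u}"
    "inj_on f ({e \<in> E. u \<in> e} - {?e0})" using star[of u] by blast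
  obtain g :: "'a set \<Rightarrow> nat" where g: "g ` ({e \<in> E. v \<in> e} - {?e0}) \<subseteq> {1..<degree E v}"
    "inj_on g ({e \<in> E. v \<in> e} - {?e0})" using star[of v] by blast
  define c where "c e = (if e = ?e0 then 0 else if u \<in> e then f e else g e)" for e
  \<comment> \<open>An edge has only two vertices, so on \<open>E\<close> the branches for
    \<open>f\<close> and \<open>g\<close> do not compete.\<close>
  have both: "e = ?e0" if "e \<in> E" "u \<in> e" "v \<in> e" for e
    using that uv simple by (fastforce simp: simple_graph_def card_2_iff)
  have f_mem: "f e \<in> {1..<degree E u}" if "e \<in> E" "u \<in> e" "e \<noteq> ?e0" for e
    using f(1) that by blast
  have g_mem: "g e \<in> {1..<degree E v}" if "e \<in> E" "v \<in> e" "e \<noteq> ?e0" for e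
    using g(1) that by blast
  have c0: "c e = 0 \<longleftrightarrow> e = ?e0" if "e \<in> E" for e
    using that f_mem[of e] g_mem[of e] meet[of e]
    by (cases "e = ?e0"; cases "u \<in> e") (simp_all add: c_def)
  have c_u: "c e = f e" if "u \<in> e" "e \<noteq> ?e0" for e
    using that by (simp add: c_def)
  have c_v: "c e = g e" if "e \<in> E" "v \<in> e" "e \<noteq> ?e0" for e
    using that both[of e] unfolding c_def by presburger
  have inj_u: "c e \<noteq> c e'" if "e \<in> E" "e' \<in> E" "u \<in> e" "u \<in> e'" "e \<noteq> e'" for e e'
    using that c0[of e] c0[of e'] c_u[of e] c_u[of e'] inj_on_contraD[OF f(2), of e e']
    by (cases "e = ?e0"; cases "e' = ?e0") simp_all
  have inj_v: "c e \<noteq> c e'" if "e \<in> E" "e' \<in> E" "v \<in> e" "v \<in> e'" "e \<noteq> e'" for e e'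
    using that c0[of e] c0[of e'] c_v[of e] c_v[of e'] inj_on_contraD[OF g(2), of e e']
    by (cases "e = ?e0"; cases "e' = ?e0") simp_all
  \<comment> \<open>Puts color 0 into the range
    \<open>{..<max (degree E u) (degree E v)}\<close>.\<close>
  have pos: "degree E u > 0"
    using uv finE by (auto simp: degree_def card_gt_0_iff)
  have "c ` E \<subseteq> {..<max (degree E u) (degree E v)}"
    using f_mem g_mem meet pos by (fastforce simp: c_def less_max_iff_disj)
  from card_mono[OF _ this] have "card (c ` E) \<le> max (degree E u) (degree E v)"
    by simp
  moreover have "conflict_free_connected V E c"
  proof -
    define P where "P x y \<longleftrightarrow> (\<exists>p. path_between V E x y p \<and> conflict_free_path c p)" for x y
    have P_sym: "P x y" if "P y x" for x y
    proof -
      from that obtain p where "path_between V E y x p" "conflict_free_path c p"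
        by (auto simp: P_def)
      then have "path_between V E x y (rev p)" "conflict_free_path c (rev p)"
        by (auto simp: path_between_def is_path_rev conflict_free_path_def path_edges_rev
            hd_rev last_rev)
      then show ?thesis by (auto simp: P_def)
    qed
    \<comment> \<open>Color 0 is the color used exactly once, since by \<open>c0\<close> no other
      edge of the tree has it.\<close>
    have P_through: "P x y" if "path_between V E x y p" "?e0 \<in> set (path_edges p)"
      "set (path_edges p) \<subseteq> E" for x y p
    proof -
      have "\<exists>!e. e \<in> set (path_edges p) \<and> c e = 0"
        using that c0 by blast
      with that(1) show ?thesis unfolding P_def conflict_free_path_def by blast
    qed
    have P_adj: "P x y" if "{x, y} \<in> E" "x \<noteq> y" for x y
    proof -
      have "x \<in> V" "y \<in> V" using that simple by (auto simp: simple_graph_def)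
      then show ?thesis unfolding P_def
        using that by (intro exI[of _ "[x, y]"])
          (auto simp: path_between_def is_path_def conflict_free_path_def path_edges_def)
    qed
    have P_two: "P x y" if "{x, w} \<in> E" "{y, w} \<in> E" "x \<noteq> y" "x \<noteq> w" "y \<noteq> w" "w = u \<or> w = v"
      for x y w
    proof -
      have "x \<in> V" "y \<in> V" "w \<in> V" using that simple by (auto simp: simple_graph_def)
      moreover have "{x, w} \<noteq> {y, w}" using that by (auto simp: doubleton_eq_iff)
      moreover from this have "c {x, w} \<noteq> c {y, w}"
        using inj_u inj_v that by blast
      ultimately show ?thesis unfolding P_def
        using that by (intro exI[of _ "[x, w, y]"])
          (auto simp: path_between_def is_path_def conflict_free_path_def path_edges_def
            insert_commute)
    qed
    have P_three: "P x y" if "{x, u} \<in> E" "{y, v} \<in> E" "x \<noteq> y" "x \<noteq> u" "x \<noteq> v" "y \<noteq> u" "y \<noteq> v"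
      for x y
      using that uv uvV simple
      by (intro P_through[of _ _ "[x, u, v, y]"])
        (auto simp: path_between_def is_path_def path_edges_def insert_commute simple_graph_def)
    have near: "{w, u} \<in> E \<or> {w, v} \<in> E" if w: "w \<in> V" "w \<noteq> u" "w \<noteq> v" for w
    proof -
      from conn w uvV obtain q where q: "path_between V E w u q"
        by (auto simp: graph_connected_def)
      with w obtain x q' where "q = w # x # q'"
        by (cases q; cases "tl q") (auto simp: path_between_def is_path_def)
      with q have "{w, x} \<in> E" by (simp add: path_between_def is_path_def)
      \<comment> \<open>The first edge of the path meets \<open>u\<close> or \<open>v\<close>, and
        it can do so only in \<open>x\<close>.\<close>
      with meet[OF this] w show ?thesis by auto
    qed
    have "P x y" if xy: "x \<in> V" "y \<in> V" "x \<noteq> y" for x y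
    proof -
      \<comment> \<open>If \<open>y\<close> is adjacent to the end of \<open>uv\<close> other than
        \<open>x\<close>, that end is the middle of a path with two edges; otherwise
        \<open>x\<close> and \<open>y\<close> are adjacent.\<close>
      have ends: "P x y" if "x \<in> {u, v}" "y \<in> V" "x \<noteq> y" for x y
      proof (cases "y \<in> {u, v}")
        case True
        with that uv show ?thesis by (intro P_adj) (auto simp: insert_commute)
      next
        case False
        with that near[of y] consider "{y, u} \<in> E" | "{y, v} \<in> E" by blast
        then show ?thesis
        proof cases
          case 1
          then show ?thesis
            using that False uv P_adj[of x y] P_two[of x u y]
            by (auto simp: insert_commute)
        next
          case 2
          then show ?thesis
            using that False uv P_adj[of x y] P_two[of x v y]
            by (auto simp: insert_commute)
        qed
      qed
      show ?thesis
      proof (cases "x \<in> {u, v} \<or> y \<in> {u, v}")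
        case True
        then show ?thesis using ends xy P_sym by metis
      next
        case False
        then show ?thesis
          using xy near[of x] near[of y] P_two[of x u y] P_two[of x v y] P_three[of x y]
            P_three[of y x] P_sym[of y x] by auto
      qed
    qed
    then show ?thesis by (auto simp: conflict_free_connected_def P_def)
  qed
  ultimately show thesis using that by blast
qed

theorem theorem2p2:
  fixes V :: "'a set" and E :: "'a set set"
  assumes "is_tree V E"
    and "diameter V E = 2 \<or> diameter V E = 3"
  shows "cfc V E = max_degree V E"
proof -
  obtain u v where uv: "u \<noteq> v" "{u, v} \<in> E" "\<And>e. e \<in> E \<Longrightarrow> u \<in> e \<or> v \<in> e"
    using tree_edge_meeting_all_edges[OF assms] by blast
  from assms have g: "simple_graph V E" "graph_connected V E"
    by (auto simp: is_tree_def)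
  then obtain c :: "'a set \<Rightarrow> nat" where c: "conflict_free_connected V E c"
    "card (c ` E) \<le> max (degree E u) (degree E v)"
    using conflict_free_coloring_of_edge_meeting_all_edges uv by metis
  have "u \<in> V" "v \<in> V" "finite V"
    using g uv by (auto simp: simple_graph_def)
  then have "max (degree E u) (degree E v) \<le> max_degree V E"
    by (simp add: max_degree_def)
  with c max_degree_le_conflict_free_colors[OF assms(1) c(1)]
  have "card (c ` E) = max_degree V E" by linarith
  with c(1) max_degree_le_conflict_free_colors[OF assms(1)] show ?thesis
    unfolding cfc_def by (intro Least_equality) auto
qed

end
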